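(* Consider the single-sensor system $x_{k+1}=Ax_k+w_k$, $y_k=Cx_k+v_k$ ($w_k,v_k$ independent zero-mean Gaussian with covariances $Q$, $R$), $(A,C)$ detectable, $(A,Q^{1/2})$ stabilizable, with local Kalman filter in steady state with filtered error covariance $\bar P$. Let $f(X)=AXA^T+Q$, $\mathcal{S}=\{f^n(\bar P):n\ge0\}$, $\lambda\in(0,1]$, $E\ge0$, $\beta\in(0,1)$. (i) (Finite horizon.) For $K\ge1$ define $J_{K+1}\equiv0$ and $J_k(P)=\min\{\beta\,\mathrm{tr}f(P)+J_{k+1}(f(P)),\ \beta[\lambda\mathrm{tr}\bar P+(1-\lambda)\mathrm{tr}f(P)]+(1-\beta)E+\lambda J_{k+1}(\bar P)+(1-\lambda)J_{k+1}(f(P))\}$ for $P\in\mathcal{S}$, and let the optimal decision $\nu_k^*(P)\in\{0,1\}$ be $0$ if the first term attains the minimum and $1$ if the second does. Then there exist thresholds $P^{th}_{k-1|k-1}$, $k=1,\dots,K$, such that $\nu_k^*=0$ if $P_{k-1|k-1}<P^{th}_{k-1|k-1}$ and $\nu_k^*=1$ if $P_{k-1|k-1}\ge P^{th}_{k-1|k-1}$, for $P_{k-1|k-1}\in\mathcal{S}$; the thresholds may be infinite (meaning $\nu_k^*=0$ for all $P_{k-1|k-1}\in\mathcal{S}$) when $A$ is stable. (ii) (Infinite horizon.) Let $(\rho,h)$ be the solution of the average-cost Bellman equation $\rho+h(P)=\min\{\beta\,\mathrm{tr}f(P)+h(f(P)),\ \beta[\lambda\mathrm{tr}\bar P+(1-\lambda)\mathrm{tr}f(P)]+(1-\beta)E+\lambda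 h(\bar P)+(1-\lambda)h(f(P))\}$ on $\mathcal{S}$ obtained as the limit of relative value iteration, and let $\nu^*(P)$ be $0$ or $1$ according to which term attains the minimum. Then the optimal policy is of the form $\nu_k^*=0$ if $P_{k-1|k-1}<P^{th}$ and $\nu_k^*=1$ if $P_{k-1|k-1}\ge P^{th}$, for some constant threshold $P^{th}$, which may be infinite when $A$ is stable.
   Context: For symmetric matrices, $X\le Y$ means $Y-X$ is positive semidefinite (by the paper's results $\mathcal{S}$ is totally ordered by this relation), and $X<Y$ means $X\le Y$, $X\ne Y$ within $\mathcal{S}$. $\nu_k=1$ means the sensor transmits its local state estimate at time $k$ over an i.i.d. channel with success probability $\lambda$, at cost $E$; the remote error covariance becomes $\bar P$ on successful reception and $f(P_{k-1|k-1})$ otherwise. A matrix is stable if all eigenvalues have modulus less than one. *)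

theory Defs
  imports "HOL-Analysis.Analysis"
begin

type_synonym 'n rmat = "real^'n^'n"

definition psd :: "real^'n^'n \<Rightarrow> bool" where
  "psd M \<longleftrightarrow> transpose M = M \<and> (\<forall>x. 0 \<le> x \<bullet> (M *v x))"

definition posdef :: "real^'n^'n \<Rightarrow> bool" where
  "posdef M \<longleftrightarrow> transpose M = M \<and> (\<forall>x. x \<noteq> 0 \<longrightarrow> 0 < x \<bullet> (M *v x))"

definition loewner_le :: "real^'n^'n \<Rightarrow> real^'n^'n \<Rightarrow> bool" where
  "loewner_le X Y \<longleftrightarrow> psd (Y - X)"

definition loewner_less :: "real^'n^'n \<Rightarrow> real^'n^'n \<Rightarrow> bool" where
  "loewner_less X Y \<longleftrightarrow> loewner_le X Y \<and> X \<noteq> Y"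

definition eigenvalue :: "real^'n^'n \<Rightarrow> complex \<Rightarrow> bool" where
  "eigenvalue A z \<longleftrightarrow> det (mat z - map_matrix complex_of_real A) = 0"

definition stable :: "real^'n^'n \<Rightarrow> bool" where
  "stable A \<longleftrightarrow> (\<forall>z. eigenvalue A z \<longrightarrow> cmod z < 1)"

definition detectable :: "real^'n^'n \<Rightarrow> real^'n^'m \<Rightarrow> bool" where
  "detectable A C \<longleftrightarrow> (\<exists>L :: real^'m^'n. stable (A + L ** C))"

definition stabilizable :: "real^'n^'n \<Rightarrow> real^'p^'n \<Rightarrow> bool" where
  "stabilizable A B \<longleftrightarrow> (\<exists>K :: real^'n^'p. stable (A + B ** K))"

definition fmap :: "real^'n^'n \<Rightarrow> real^'n^'n \<Rightarrow> real^'n^'n \<Rightarrow> real^'n^'n" where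
  "fmap A Q X = A ** X ** transpose A + Q"

definition Sset :: "real^'n^'n \<Rightarrow> real^'n^'n \<Rightarrow> real^'n^'n \<Rightarrow> (real^'n^'n) set" where
  "Sset A Q Pbar = range (\<lambda>n. (fmap A Q ^^ n) Pbar)"

definition cost0 :: "real^'n^'n \<Rightarrow> real^'n^'n \<Rightarrow> real \<Rightarrow> real^'n^'n \<Rightarrow> real" where
  "cost0 A Q \<beta> P = \<beta> * trace (fmap A Q P)"

definition cost1 :: "real^'n^'n \<Rightarrow> real^'n^'n \<Rightarrow> real^'n^'n \<Rightarrow> real \<Rightarrow> real \<Rightarrow> real
    \<Rightarrow> real^'n^'n \<Rightarrow> real" where
  "cost1 A Q Pbar lam E \<beta> P =
     \<beta> * (lam * trace Pbar + (1 - lam) * trace (fmap A Q P)) + (1 - \<beta>) * E"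

definition qval0 :: "real^'n^'n \<Rightarrow> real^'n^'n \<Rightarrow> real \<Rightarrow> (real^'n^'n \<Rightarrow> real)
    \<Rightarrow> real^'n^'n \<Rightarrow> real" where
  "qval0 A Q \<beta> h P = cost0 A Q \<beta> P + h (fmap A Q P)"

definition qval1 :: "real^'n^'n \<Rightarrow> real^'n^'n \<Rightarrow> real^'n^'n \<Rightarrow> real \<Rightarrow> real \<Rightarrow> real
    \<Rightarrow> (real^'n^'n \<Rightarrow> real) \<Rightarrow> real^'n^'n \<Rightarrow> real" where
  "qval1 A Q Pbar lam E \<beta> h P =
     cost1 A Q Pbar lam E \<beta> P + lam * h Pbar + (1 - lam) * h (fmap A Q P)"

definition bellman :: "real^'n^'n \<Rightarrow> real^'n^'n \<Rightarrow> real^'n^'n \<Rightarrow> real \<Rightarrow> real \<Rightarrow> real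
    \<Rightarrow> (real^'n^'n \<Rightarrow> real) \<Rightarrow> real^'n^'n \<Rightarrow> real" where
  "bellman A Q Pbar lam E \<beta> h P =
     min (qval0 A Q \<beta> h P) (qval1 A Q Pbar lam E \<beta> h P)"

(* decision attaining the minimum (ties broken in favour of nu = 0) *)
definition decision :: "real^'n^'n \<Rightarrow> real^'n^'n \<Rightarrow> real^'n^'n \<Rightarrow> real \<Rightarrow> real \<Rightarrow> real
    \<Rightarrow> (real^'n^'n \<Rightarrow> real) \<Rightarrow> real^'n^'n \<Rightarrow> nat" where
  "decision A Q Pbar lam E \<beta> h P =
     (if qval0 A Q \<beta> h P \<le> qval1 A Q Pbar lam E \<beta> h P then 0 else 1)"

fun Vrem :: "real^'n^'n \<Rightarrow> real^'n^'n \<Rightarrow> real^'n^'n \<Rightarrow> real \<Rightarrow> real \<Rightarrow> real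
    \<Rightarrow> nat \<Rightarrow> real^'n^'n \<Rightarrow> real" where
  "Vrem A Q Pbar lam E \<beta> 0 = (\<lambda>P. 0)"
| "Vrem A Q Pbar lam E \<beta> (Suc m) = bellman A Q Pbar lam E \<beta> (Vrem A Q Pbar lam E \<beta> m)"

(* finite horizon value J_k for horizon K (k = 1..K+1); J_{K+1} = 0 *)
definition Jfin :: "real^'n^'n \<Rightarrow> real^'n^'n \<Rightarrow> real^'n^'n \<Rightarrow> real \<Rightarrow> real \<Rightarrow> real
    \<Rightarrow> nat \<Rightarrow> nat \<Rightarrow> real^'n^'n \<Rightarrow> real" where
  "Jfin A Q Pbar lam E \<beta> K k = Vrem A Q Pbar lam E \<beta> (K + 1 - k)"

definition nu_fin :: "real^'n^'n \<Rightarrow> real^'n^'n \<Rightarrow> real^'n^'n \<Rightarrow> real \<Rightarrow> real \<Rightarrow> real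
    \<Rightarrow> nat \<Rightarrow> nat \<Rightarrow> real^'n^'n \<Rightarrow> nat" where
  "nu_fin A Q Pbar lam E \<beta> K k =
     decision A Q Pbar lam E \<beta> (Jfin A Q Pbar lam E \<beta> K (k + 1))"

fun rvi :: "real^'n^'n \<Rightarrow> real^'n^'n \<Rightarrow> real^'n^'n \<Rightarrow> real \<Rightarrow> real \<Rightarrow> real
    \<Rightarrow> nat \<Rightarrow> real^'n^'n \<Rightarrow> real" where
  "rvi A Q Pbar lam E \<beta> 0 = (\<lambda>P. 0)"
| "rvi A Q Pbar lam E \<beta> (Suc n) =
     (\<lambda>P. bellman A Q Pbar lam E \<beta> (rvi A Q Pbar lam E \<beta> n) P
          - bellman A Q Pbar lam E \<beta> (rvi A Q Pbar lam E \<beta> n) Pbar)"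

end

theory Submission
  imports Defs
begin

text \<open>
Since \<open>Pbar \<le> f Pbar\<close> and \<open>f\<close> is monotone, the orbit \<open>S\<close> is a chain in the Loewner order along
which the traces increase. The Bellman operator preserves monotonicity along this chain, hence
so do the finite-horizon values and the limit \<open>h\<close> of relative value iteration. The difference of
the two Q-values is then increasing along the chain, so the decision switches from 0 to 1 at
most once, and the first switching point is the threshold. If it never switches, the traces
along \<open>S\<close> are bounded. This forces \<open>A\<close> to be stable: if \<open>v\<close> were a left eigenvector of \<open>A\<close>
with eigenvalue \<open>|z| \<ge> 1\<close>, stabilizability of \<open>(A, Qh)\<close> would give \<open>v\<^sup>* Q v > 0\<close>, so that
\<open>v\<^sup>* f\<^sup>n(X) v \<ge> n v\<^sup>* Q v\<close> would grow without bound.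
\<close>

lemma transpose_add: "transpose ((M::'a::semiring_1^'n^'m) + N) = transpose M + transpose N"
  by (simp add: transpose_def vec_eq_iff)

lemma transpose_diff: "transpose ((M::'a::ring_1^'n^'m) - N) = transpose M - transpose N"
  by (simp add: transpose_def vec_eq_iff)

lemma transpose_zero: "transpose (0::'a::semiring_1^'n^'m) = 0"
  by (simp add: transpose_def vec_eq_iff)

lemma matrix_sub_ldistrib: "(A::'a::ring_1^'n^'m) ** (B - C) = A ** B - A ** C"
  by (simp add: matrix_matrix_mult_def vec_eq_iff sum_subtractf algebra_simps)

lemma matrix_sub_rdistrib: "((B::'a::ring_1^'n^'m) - C) ** A = B ** A - C ** A"
  by (simp add: matrix_matrix_mult_def vec_eq_iff sum_subtractf algebra_simps)

lemma inner_matrix_vector_transpose: "(x::real^'n) \<bullet> (M *v y) = (transpose M *v x) \<bullet> y"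
  by (simp add: dot_lmul_matrix)

lemma inner_axis_matrix_axis: "axis i 1 \<bullet> ((M::real^'n^'n) *v axis j 1) = M$i$j"
  by (simp add: matrix_vector_mult_def inner_axis axis_def inner_vec_def if_distrib if_distribR
      sum.delta cong: if_cong)

lemma mat_matrix_vector_mult: "mat z *v (v::'a::comm_ring_1^'n) = z *s v"
  by (simp add: mat_def matrix_vector_mult_def vec_eq_iff if_distrib if_distribR sum.delta
      cong: if_cong)

section \<open>Positive semidefinite matrices and the Loewner order\<close>

lemma psd_congruence:
  fixes M :: "real^'k^'k" and B :: "real^'k^'n"
  assumes "psd M"
  shows "psd (B ** M ** transpose B)"
proof -
  have "transpose M = M" using assms by (simp add: psd_def)
  then have "transpose (B ** M ** transpose B) = B ** M ** transpose B"
    by (simp add: matrix_transpose_mul matrix_mul_assoc)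
  moreover have "0 \<le> x \<bullet> ((B ** M ** transpose B) *v x)" for x
  proof -
    have "x \<bullet> ((B ** M ** transpose B) *v x) = (transpose B *v x) \<bullet> (M *v (transpose B *v x))"
      by (metis inner_matrix_vector_transpose matrix_vector_mul_assoc inner_commute)
    then show ?thesis using assms by (simp add: psd_def)
  qed
  ultimately show ?thesis by (simp add: psd_def)
qed

lemma psd_add: "psd M \<Longrightarrow> psd N \<Longrightarrow> psd (M + N)"
  by (simp add: psd_def matrix_vector_mult_add_rdistrib inner_add_right transpose_add)

lemma psd_zero: "psd (0::real^'n^'n)"
  by (simp add: psd_def transpose_zero)

lemma psd_mat_1: "psd (mat 1 :: real^'n^'n)"
  by (simp add: psd_def)

lemma psd_posdef_add: "psd M \<Longrightarrow> posdef N \<Longrightarrow> posdef (M + N)"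
  by (simp add: psd_def posdef_def transpose_add matrix_vector_mult_add_rdistrib
      inner_add_right add_nonneg_pos)

lemma psd_diag_nonneg: "psd M \<Longrightarrow> 0 \<le> M$i$i"
  by (metis inner_axis_matrix_axis psd_def)

lemma psd_trace_nonneg: "psd M \<Longrightarrow> 0 \<le> trace M"
  by (simp add: trace_def psd_diag_nonneg sum_nonneg)

lemma psd_antisym:
  assumes "psd M" "psd (-M)"
  shows "M = 0"
proof -
  have sym: "transpose M = M" using assms by (simp add: psd_def)
  have "(-M) *v x = - (M *v x)" for x
    by (simp add: matrix_vector_mult_def vec_eq_iff sum_negf)
  then have quad_zero: "x \<bullet> (M *v x) = 0" for x
    using assms unfolding psd_def by (metis inner_minus_right neg_0_le_iff_le order_antisym)
  have "x \<bullet> (M *v y) = 0" for x y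
  proof -
    have "(x+y) \<bullet> (M *v (x+y)) = x \<bullet> (M *v x) + y \<bullet> (M *v y) + x \<bullet> (M *v y) + y \<bullet> (M *v x)"
      by (simp add: matrix_vector_right_distrib inner_add_left inner_add_right)
    moreover have "y \<bullet> (M *v x) = x \<bullet> (M *v y)"
      by (metis inner_matrix_vector_transpose inner_commute sym)
    ultimately show ?thesis using quad_zero[of x] quad_zero[of y] quad_zero[of "x+y"] by simp
  qed
  then have "M *v y = 0" for y by (metis inner_eq_zero_iff)
  then show ?thesis by (metis matrix_eq matrix_vector_mult_0)
qed

lemma psd_entry_abs_le_trace:
  assumes "psd M"
  shows "\<bar>M$i$j\<bar> \<le> 2 * trace M"
proof -
  have sym: "M$j$i = M$i$j" using assms unfolding psd_def by (metis transpose_def vec_lambda_beta)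
  have "(axis i 1 + s *\<^sub>R axis j 1) \<bullet> (M *v (axis i 1 + s *\<^sub>R axis j 1))
      = M$i$i + s * M$i$j + s * M$j$i + s * s * M$j$j" for s
    by (simp add: matrix_vector_right_distrib matrix_vector_mult_scaleR inner_add_left
        inner_add_right inner_axis_matrix_axis algebra_simps)
  then have quad: "0 \<le> M$i$i + s * M$i$j + s * M$j$i + s * s * M$j$j" for s
    using assms unfolding psd_def by metis
  have "M$i$i \<le> trace M" "M$j$j \<le> trace M"
    unfolding trace_def using psd_diag_nonneg[OF assms] by (auto intro!: member_le_sum)
  with quad[of 1] quad[of "-1"] sym show ?thesis by (simp add: abs_le_iff)
qed

lemma psd_quadratic_form_le_trace:
  assumes "psd (M::real^'n^'n)"
  shows "x \<bullet> (M *v x) \<le> 2 * trace M * (\<Sum>i\<in>UNIV. \<bar>x$i\<bar>)^2"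
proof -
  have "x \<bullet> (M *v x) = (\<Sum>i\<in>UNIV. \<Sum>j\<in>UNIV. x$i * M$i$j * x$j)"
    by (simp add: inner_vec_def matrix_vector_mult_def sum_distrib_left mult.assoc)
  also have "\<dots> \<le> (\<Sum>i\<in>UNIV. \<Sum>j\<in>UNIV. \<bar>x$i\<bar> * (2 * trace M) * \<bar>x$j\<bar>)"
  proof (intro sum_mono)
    fix i j
    have "x$i * M$i$j * x$j \<le> \<bar>x$i\<bar> * \<bar>M$i$j\<bar> * \<bar>x$j\<bar>"
      by (metis abs_ge_self abs_mult)
    also have "\<dots> \<le> \<bar>x$i\<bar> * (2 * trace M) * \<bar>x$j\<bar>"
      using psd_entry_abs_le_trace[OF assms, of i j] by (simp add: mult_mono mult_right_mono)
    finally show "x$i * M$i$j * x$j \<le> \<bar>x$i\<bar> * (2 * trace M) * \<bar>x$j\<bar>" .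
  qed
  also have "\<dots> = 2 * trace M * (\<Sum>i\<in>UNIV. \<bar>x$i\<bar>)^2"
    by (simp add: power2_eq_square sum_distrib_left sum_distrib_right mult_ac)
  finally show ?thesis .
qed

lemma psd_matrix_inv:
  fixes S :: "real^'m^'m"
  assumes "posdef S"
  shows "psd (matrix_inv S)"
proof -
  have sym: "transpose S = S" and pd: "\<And>x. x \<noteq> 0 \<Longrightarrow> 0 < x \<bullet> (S *v x)"
    using assms by (auto simp: posdef_def)
  have "inj ((*v) S)"
  proof (rule injI)
    fix x y assume "S *v x = S *v y"
    then have "S *v (x - y) = 0" by (simp add: matrix_vector_mult_diff_distrib)
    then show "x = y" using pd[of "x - y"] by force
  qed
  then have "invertible S"
    using matrix_left_invertible_injective invertible_left_inverse by blast
  then have inv: "S ** matrix_inv S = mat 1" "matrix_inv S ** S = mat 1"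
    unfolding invertible_def matrix_inv_def by (metis (mono_tags, lifting) someI_ex)+
  let ?N = "matrix_inv S"
  have "transpose ?N ** S = mat 1"
    by (metis inv(1) matrix_transpose_mul sym transpose_mat)
  then have sym_inv: "transpose ?N = ?N"
    by (metis inv(1) matrix_mul_assoc matrix_mul_lid matrix_mul_rid)
  have "0 \<le> y \<bullet> (?N *v y)" for y
  proof -
    have "S *v (?N *v y) = y" by (simp add: matrix_vector_mul_assoc inv)
    then have "y \<bullet> (?N *v y) = (?N *v y) \<bullet> (S *v (?N *v y))" by (simp add: inner_commute)
    then show ?thesis using pd[of "?N *v y"] by (cases "?N *v y = 0") auto
  qed
  with sym_inv show ?thesis by (simp add: psd_def)
qed

lemma loewner_refl: "loewner_le X (X::real^'n^'n)"
  by (simp add: loewner_le_def psd_zero)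

lemma loewner_trans: "loewner_le X Y \<Longrightarrow> loewner_le Y Z \<Longrightarrow> loewner_le X (Z::real^'n^'n)"
  unfolding loewner_le_def by (drule (1) psd_add) (simp add: add.commute)

lemma loewner_antisym: "loewner_le X Y \<Longrightarrow> loewner_le Y X \<Longrightarrow> X = (Y::real^'n^'n)"
  unfolding loewner_le_def using psd_antisym[of "Y - X"] by simp

lemma trace_mono_loewner: "loewner_le X Y \<Longrightarrow> trace X \<le> trace (Y::real^'n^'n)"
  using psd_trace_nonneg[of "Y - X"] by (simp add: loewner_le_def trace_sub)

lemma fmap_diff: "fmap A Q X - fmap A Q Y = A ** (X - Y) ** transpose A"
  by (simp add: fmap_def matrix_sub_ldistrib matrix_sub_rdistrib)

lemma psd_fmap: "psd Q \<Longrightarrow> psd X \<Longrightarrow> psd (fmap A Q X)"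
  unfolding fmap_def by (intro psd_add psd_congruence)

lemma psd_funpow_fmap: "psd Q \<Longrightarrow> psd X \<Longrightarrow> psd ((fmap A Q ^^ n) X)"
  by (induction n) (simp_all add: psd_fmap)

lemma fmap_loewner_mono: "loewner_le X Y \<Longrightarrow> loewner_le (fmap A Q X) (fmap A Q Y)"
  unfolding loewner_le_def fmap_diff by (rule psd_congruence)

lemma lyapunov_orbit_loewner_mono:
  assumes "loewner_le X (fmap A Q X)" and "m \<le> n"
  shows "loewner_le ((fmap A Q ^^ m) X) ((fmap A Q ^^ n) X)"
proof -
  have one_step: "loewner_le ((fmap A Q ^^ k) X) ((fmap A Q ^^ Suc k) X)" for k
    by (induction k) (simp_all add: assms(1) fmap_loewner_mono)
  from \<open>m \<le> n\<close> show ?thesis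
  proof (induction n rule: dec_induct)
    case base show ?case by (rule loewner_refl)
  next
    case (step k) then show ?case using loewner_trans one_step by blast
  qed
qed

lemma lyapunov_orbit_trace_incseq:
  "loewner_le X (fmap A Q X) \<Longrightarrow> incseq (\<lambda>n. trace ((fmap A Q ^^ n) X))"
  unfolding incseq_def using lyapunov_orbit_loewner_mono trace_mono_loewner by blast

lemma steady_state_riccati:
  fixes A Q Pp Pbar :: "real^'n^'n" and C :: "real^'n^'m" and R :: "real^'m^'m"
  assumes R_pd: "posdef R" and Pp_psd: "psd Pp"
    and DARE: "Pp = A ** Pp ** transpose A + Q
                 - A ** Pp ** transpose C ** matrix_inv (C ** Pp ** transpose C + R)
                     ** C ** Pp ** transpose A"
    and Pbar_def: "Pbar = Pp - Pp ** transpose C ** matrix_inv (C ** Pp ** transpose C + R)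
                              ** C ** Pp"
  shows "fmap A Q Pbar = Pp" and "loewner_le Pbar Pp"
proof -
  define N where "N = matrix_inv (C ** Pp ** transpose C + R)"
  have "fmap A Q Pbar = A ** Pp ** transpose A + Q - A ** Pp ** transpose C ** N ** C ** Pp ** transpose A"
    unfolding fmap_def Pbar_def N_def by (simp add: matrix_sub_ldistrib matrix_sub_rdistrib matrix_mul_assoc)
  then show "fmap A Q Pbar = Pp" using DARE unfolding N_def by simp
  have "posdef (C ** Pp ** transpose C + R)"
    using psd_posdef_add[OF psd_congruence[OF Pp_psd] R_pd] by simp
  then have "psd ((Pp ** transpose C) ** N ** transpose (Pp ** transpose C))"
    unfolding N_def by (intro psd_congruence psd_matrix_inv)
  moreover have "transpose Pp = Pp" using Pp_psd by (simp add: psd_def)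
  ultimately show "loewner_le Pbar Pp"
    unfolding loewner_le_def Pbar_def N_def by (simp add: matrix_transpose_mul matrix_mul_assoc)
qed

section \<open>Unstable eigenvalues and unbounded Lyapunov orbits\<close>

lemma left_eigenvector_of_eigenvalue:
  assumes "eigenvalue A z"
  obtains v :: "complex^'n" where "v \<noteq> 0" "v v* map_matrix complex_of_real A = z *s v"
proof -
  let ?M = "transpose (mat z - map_matrix complex_of_real (A::real^'n^'n))"
  have "det ?M = 0" using assms by (simp add: eigenvalue_def)
  then have "\<not> inj ((*v) ?M)"
    using det_nz_iff_inj_gen[OF matrix_vector_mul_linear_gen, of ?M] by simp
  then obtain x y where "x \<noteq> y" "?M *v x = ?M *v y" unfolding inj_def by blast
  then have "?M *v (x - y) = 0" "x - y \<noteq> 0"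
    by (auto simp: matrix_vector_mult_diff_distrib)
  moreover have "?M *v w = z *s w - w v* map_matrix complex_of_real A" for w
    by (simp add: transpose_diff matrix_vector_mult_diff_rdistrib mat_matrix_vector_mult)
  ultimately show ?thesis using that by (metis eq_iff_diff_eq_0)
qed

lemma eigenvalue_of_left_eigenvector:
  assumes "(v::complex^'n) \<noteq> 0" "v v* map_matrix complex_of_real A = z *s v"
  shows "eigenvalue A z"
proof -
  let ?M = "transpose (mat z - map_matrix complex_of_real (A::real^'n^'n))"
  have "?M *v w = z *s w - w v* map_matrix complex_of_real A" for w
    by (simp add: transpose_diff matrix_vector_mult_diff_rdistrib mat_matrix_vector_mult)
  then have "?M *v v = ?M *v 0" using assms by simp
  then have "\<not> inj ((*v) ?M)" using assms(1) unfolding inj_def by blast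
  then have "det ?M = 0"
    using det_nz_iff_inj_gen[OF matrix_vector_mul_linear_gen, of ?M] by simp
  then show ?thesis by (simp add: eigenvalue_def)
qed

definition Re_vec :: "complex^'n \<Rightarrow> real^'n" where "Re_vec v = (\<chi> i. Re (v$i))"
definition Im_vec :: "complex^'n \<Rightarrow> real^'n" where "Im_vec v = (\<chi> i. Im (v$i))"

lemma left_eigenvector_Re_Im_iff:
  "v v* map_matrix complex_of_real A = z *s v \<longleftrightarrow>
   (Re_vec v v* A = Re z *\<^sub>R Re_vec v - Im z *\<^sub>R Im_vec v \<and>
    Im_vec v v* A = Im z *\<^sub>R Re_vec v + Re z *\<^sub>R Im_vec v)"
  by (auto simp: vec_eq_iff complex_eq_iff vector_matrix_mult_def Re_vec_def Im_vec_def)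

text \<open>The Popov-Belevitch-Hautus test: a mode of \<open>A\<close> that \<open>B\<close> cannot reach must be stable.\<close>

lemma eigenvalue_lt_1_if_stabilizable:
  fixes A :: "real^'n^'n" and B :: "real^'p^'n"
  assumes "stabilizable A B" "v \<noteq> 0" and eig: "v v* map_matrix complex_of_real A = z *s v"
    and "Re_vec v v* B = 0" "Im_vec v v* B = 0"
  shows "cmod z < 1"
proof -
  obtain K where stable_K: "stable (A + B ** K)" using assms(1) unfolding stabilizable_def by blast
  have "Re_vec v v* (A + B ** K) = Re_vec v v* A" "Im_vec v v* (A + B ** K) = Im_vec v v* A"
    using assms(4,5) by (simp_all add: vector_matrix_mult_add_rdistrib vector_matrix_mul_assoc[symmetric])
  then have "v v* map_matrix complex_of_real (A + B ** K) = z *s v"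
    using eig unfolding left_eigenvector_Re_Im_iff by simp
  then have "eigenvalue (A + B ** K) z" using eigenvalue_of_left_eigenvector \<open>v \<noteq> 0\<close> by blast
  with stable_K show ?thesis unfolding stable_def by blast
qed

text \<open>For \<open>v = a + i b\<close> and symmetric real \<open>M\<close>, this is the Hermitian form \<open>v\<^sup>* M v\<close>.\<close>

definition hermitian_form :: "real^'n \<Rightarrow> real^'n \<Rightarrow> real^'n^'n \<Rightarrow> real" where
  "hermitian_form a b M = a \<bullet> (M *v a) + b \<bullet> (M *v b)"

lemma hermitian_form_add: "hermitian_form a b (M + N) = hermitian_form a b M + hermitian_form a b N"
  by (simp add: hermitian_form_def matrix_vector_mult_add_rdistrib inner_add_right)

lemma hermitian_form_nonneg: "psd M \<Longrightarrow> 0 \<le> hermitian_form a b M"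
  by (simp add: hermitian_form_def psd_def add_nonneg_nonneg)

lemma hermitian_form_le_trace:
  "psd M \<Longrightarrow> hermitian_form a b M \<le> 2 * trace M * ((\<Sum>i\<in>UNIV. \<bar>a$i\<bar>)^2 + (\<Sum>i\<in>UNIV. \<bar>b$i\<bar>)^2)"
  unfolding hermitian_form_def distrib_left
  by (intro add_mono psd_quadratic_form_le_trace)

lemma hermitian_form_congruence:
  fixes A M :: "real^'n^'n"
  assumes "a v* A = x *\<^sub>R a - y *\<^sub>R b" "b v* A = y *\<^sub>R a + x *\<^sub>R b"
  shows "hermitian_form a b (A ** M ** transpose A) = (x^2 + y^2) * hermitian_form a b M"
proof -
  have congr: "c \<bullet> ((A ** M ** transpose A) *v c) = (c v* A) \<bullet> (M *v (c v* A))" for c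
    by (metis inner_matrix_vector_transpose matrix_vector_mul_assoc transpose_matrix_vector)
  have "M *v (x *\<^sub>R a - y *\<^sub>R b) = x *\<^sub>R (M *v a) - y *\<^sub>R (M *v b)"
       "M *v (y *\<^sub>R a + x *\<^sub>R b) = y *\<^sub>R (M *v a) + x *\<^sub>R (M *v b)"
    by (simp_all add: matrix_vector_mult_diff_distrib matrix_vector_right_distrib
        matrix_vector_mult_scaleR)
  then show ?thesis unfolding hermitian_form_def congr assms
    by (simp add: inner_diff_left inner_diff_right inner_add_left inner_add_right
        power2_eq_square algebra_simps)
qed

lemma hermitian_form_square_le_0:
  fixes Qh :: "real^'n^'n"
  assumes "transpose Qh = Qh" and "hermitian_form a b (Qh ** Qh) \<le> 0"
  shows "a v* Qh = 0" "b v* Qh = 0"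
proof -
  have norm: "c \<bullet> ((Qh ** Qh) *v c) = (Qh *v c) \<bullet> (Qh *v c)" for c
    by (metis assms(1) inner_matrix_vector_transpose matrix_vector_mul_assoc)
  have "(Qh *v a) \<bullet> (Qh *v a) = 0" "(Qh *v b) \<bullet> (Qh *v b) = 0"
    using assms(2) unfolding hermitian_form_def norm by (smt (verit) inner_ge_zero)+
  then show "a v* Qh = 0" "b v* Qh = 0"
    by (metis assms(1) inner_eq_zero_iff transpose_matrix_vector)+
qed

lemma lyapunov_orbit_hermitian_form_growth:
  assumes "a v* A = x *\<^sub>R a - y *\<^sub>R b" "b v* A = y *\<^sub>R a + x *\<^sub>R b" and "1 \<le> x^2 + y^2"
    and "psd Q" "psd X"
  shows "real n * hermitian_form a b Q \<le> hermitian_form a b ((fmap A Q ^^ n) X)"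
proof (induction n)
  case 0 show ?case using hermitian_form_nonneg[OF \<open>psd X\<close>] by simp
next
  case (Suc n)
  let ?M = "(fmap A Q ^^ n) X"
  have "hermitian_form a b ?M \<le> (x^2 + y^2) * hermitian_form a b ?M"
    using mult_right_mono[OF \<open>1 \<le> x^2 + y^2\<close>
        hermitian_form_nonneg[OF psd_funpow_fmap[OF \<open>psd Q\<close> \<open>psd X\<close>]]] by simp
  moreover have "hermitian_form a b ((fmap A Q ^^ Suc n) X)
      = (x^2 + y^2) * hermitian_form a b ?M + hermitian_form a b Q"
    by (simp add: fmap_def hermitian_form_add hermitian_form_congruence[OF assms(1,2)])
  ultimately show ?case using Suc.IH by (simp add: algebra_simps)
qed

lemma stable_if_lyapunov_orbit_bounded:
  fixes A Q Qh X :: "real^'n^'n"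
  assumes Qh: "psd Qh" "Qh ** Qh = Q" and stab: "stabilizable A Qh" and "psd X"
    and bounded: "\<And>n. trace ((fmap A Q ^^ n) X) \<le> B"
  shows "stable A"
proof (rule ccontr)
  assume "\<not> stable A"
  then obtain z where "eigenvalue A z" and z_ge_1: "1 \<le> cmod z"
    unfolding stable_def by (auto simp: not_less)
  obtain v where "v \<noteq> 0" and eig: "v v* map_matrix complex_of_real A = z *s v"
    using left_eigenvector_of_eigenvalue[OF \<open>eigenvalue A z\<close>] by blast
  define a where "a = Re_vec v"
  define b where "b = Im_vec v"
  have eig_a: "a v* A = Re z *\<^sub>R a - Im z *\<^sub>R b" and eig_b: "b v* A = Im z *\<^sub>R a + Re z *\<^sub>R b"
    using eig unfolding left_eigenvector_Re_Im_iff a_def b_def by auto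
  have "1 \<le> (Re z)^2 + (Im z)^2"
    using z_ge_1 by (simp add: cmod_power2[symmetric] one_le_power)
  moreover have sym_Qh: "transpose Qh = Qh" using Qh(1) by (simp add: psd_def)
  then have "psd Q"
    using psd_congruence[OF psd_mat_1, of Qh] Qh(2) by simp
  ultimately have growth: "real n * hermitian_form a b Q \<le> hermitian_form a b ((fmap A Q ^^ n) X)" for n
    using lyapunov_orbit_hermitian_form_growth[OF eig_a eig_b] \<open>psd X\<close> by blast
  have Q_pos: "0 < hermitian_form a b Q"
  proof (rule ccontr)
    assume "\<not> 0 < hermitian_form a b Q"
    then have "a v* Qh = 0" "b v* Qh = 0"
      using hermitian_form_square_le_0[OF sym_Qh, of a b] Qh(2) by simp_all
    then have "cmod z < 1"
      using eigenvalue_lt_1_if_stabilizable[OF stab \<open>v \<noteq> 0\<close> eig] unfolding a_def b_def by blast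
    with z_ge_1 show False by simp
  qed
  define c where "c = 2 * B * ((\<Sum>i\<in>UNIV. \<bar>a$i\<bar>)^2 + (\<Sum>i\<in>UNIV. \<bar>b$i\<bar>)^2)"
  have upper: "hermitian_form a b ((fmap A Q ^^ n) X) \<le> c" for n
    using hermitian_form_le_trace[OF psd_funpow_fmap[OF \<open>psd Q\<close> \<open>psd X\<close>], of a b n]
      bounded[of n] unfolding c_def
    by (smt (verit, ccfv_threshold) mult_right_mono zero_le_power2 add_nonneg_nonneg)
  obtain n where "c / hermitian_form a b Q < real n"
    using reals_Archimedean2 by blast
  then have "c < real n * hermitian_form a b Q" using Q_pos by (simp add: divide_less_eq)
  with growth[of n] upper[of n] show False by linarith
qed

section \<open>Monotonicity of the value functions along the orbit\<close>

lemma bellman_incseq_orbit: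
  assumes "incseq (\<lambda>n. trace ((fmap A Q ^^ n) X))" and "incseq (\<lambda>n. g ((fmap A Q ^^ n) X))"
    and "0 \<le> lam" "lam \<le> 1" "0 \<le> \<beta>"
  shows "incseq (\<lambda>n. bellman A Q Pbar lam E \<beta> g ((fmap A Q ^^ n) X))"
proof (rule incseq_SucI)
  fix n
  let ?w = "\<lambda>n. \<beta> * trace ((fmap A Q ^^ n) X) + g ((fmap A Q ^^ n) X)"
  have "trace ((fmap A Q ^^ Suc n) X) \<le> trace ((fmap A Q ^^ Suc (Suc n)) X)"
    using incseq_SucD[OF assms(1), of "Suc n"] by simp
  moreover have "g ((fmap A Q ^^ Suc n) X) \<le> g ((fmap A Q ^^ Suc (Suc n)) X)"
    using incseq_SucD[OF assms(2), of "Suc n"] by simp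
  ultimately have w: "?w (Suc n) \<le> ?w (Suc (Suc n))"
    using assms(5) by (intro add_mono mult_left_mono)
  have "qval1 A Q Pbar lam E \<beta> g P = \<beta> * lam * trace Pbar + (1-\<beta>) * E + lam * g Pbar
           + (1 - lam) * (\<beta> * trace (fmap A Q P) + g (fmap A Q P))" for P
    by (simp add: qval1_def cost1_def algebra_simps)
  then have "qval1 A Q Pbar lam E \<beta> g ((fmap A Q ^^ n) X)
      \<le> qval1 A Q Pbar lam E \<beta> g ((fmap A Q ^^ Suc n) X)"
    using w assms(4) by (simp add: mult_left_mono)
  moreover have "qval0 A Q \<beta> g ((fmap A Q ^^ n) X) \<le> qval0 A Q \<beta> g ((fmap A Q ^^ Suc n) X)"
    using w by (simp add: qval0_def cost0_def)
  ultimately show "bellman A Q Pbar lam E \<beta> g ((fmap A Q ^^ n) X)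
      \<le> bellman A Q Pbar lam E \<beta> g ((fmap A Q ^^ Suc n) X)"
    unfolding bellman_def by (intro min.mono)
qed

lemma Vrem_incseq_orbit:
  assumes "incseq (\<lambda>n. trace ((fmap A Q ^^ n) X))" "0 \<le> lam" "lam \<le> 1" "0 \<le> \<beta>"
  shows "incseq (\<lambda>n. Vrem A Q Pbar lam E \<beta> m ((fmap A Q ^^ n) X))"
  by (induction m) (simp_all add: assms bellman_incseq_orbit)

lemma rvi_incseq_orbit:
  assumes "incseq (\<lambda>n. trace ((fmap A Q ^^ n) X))" "0 \<le> lam" "lam \<le> 1" "0 \<le> \<beta>"
  shows "incseq (\<lambda>n. rvi A Q Pbar lam E \<beta> m ((fmap A Q ^^ n) X))"
proof (induction m)
  case (Suc m)
  have "incseq (\<lambda>n. bellman A Q Pbar lam E \<beta> (rvi A Q Pbar lam E \<beta> m) ((fmap A Q ^^ n) X))"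
    using bellman_incseq_orbit[OF assms(1) Suc.IH assms(2-4)] .
  then show ?case by (simp add: incseq_def)
qed simp

lemma rvi_limit_incseq_orbit:
  assumes "incseq (\<lambda>n. trace ((fmap A Q ^^ n) X))" "0 \<le> lam" "lam \<le> 1" "0 \<le> \<beta>"
    and lim: "\<And>n. (\<lambda>m. rvi A Q Pbar lam E \<beta> m ((fmap A Q ^^ n) X)) \<longlonglongrightarrow> h ((fmap A Q ^^ n) X)"
  shows "incseq (\<lambda>n. h ((fmap A Q ^^ n) X))"
proof (rule incseq_SucI)
  fix n
  have "rvi A Q Pbar lam E \<beta> m ((fmap A Q ^^ n) X) \<le> rvi A Q Pbar lam E \<beta> m ((fmap A Q ^^ Suc n) X)"
    for m
    using rvi_incseq_orbit[OF assms(1-4)] by (rule incseq_SucD)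
  with lim[of n] lim[of "Suc n"] show "h ((fmap A Q ^^ n) X) \<le> h ((fmap A Q ^^ Suc n) X)"
    by (intro LIMSEQ_le) auto
qed

section \<open>Threshold structure of the decision\<close>

lemma decision_eq_1_iff:
  "decision A Q Pbar lam E \<beta> h P = 1 \<longleftrightarrow>
     (1 - \<beta>) * E < lam * ((\<beta> * trace (fmap A Q P) + h (fmap A Q P)) - (\<beta> * trace Pbar + h Pbar))"
proof -
  have "qval0 A Q \<beta> h P - qval1 A Q Pbar lam E \<beta> h P
      = lam * ((\<beta> * trace (fmap A Q P) + h (fmap A Q P)) - (\<beta> * trace Pbar + h Pbar)) - (1 - \<beta>) * E"
    by (simp add: qval0_def qval1_def cost0_def cost1_def algebra_simps)
  then show ?thesis by (auto simp: decision_def)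
qed

lemma threshold_of_monotone_decision:
  fixes P :: "nat \<Rightarrow> real^'n^'n" and d :: "real^'n^'n \<Rightarrow> nat"
  assumes chain: "\<And>m n. m \<le> n \<Longrightarrow> loewner_le (P m) (P n)"
    and upward: "\<And>m n. d (P m) = 1 \<Longrightarrow> m \<le> n \<Longrightarrow> d (P n) = 1"
    and binary: "\<And>X. d X = 0 \<or> d X = 1"
    and switch: "d (P N) = 1"
  shows "\<exists>Pth\<in>range P. \<forall>X\<in>range P.
           (loewner_less X Pth \<longrightarrow> d X = 0) \<and> (loewner_le Pth X \<longrightarrow> d X = 1)"
proof -
  define N0 where "N0 = (LEAST n. d (P n) = 1)"
  have switch_N0: "d (P N0) = 1" unfolding N0_def using switch by (rule LeastI)
  have "(loewner_less (P m) (P N0) \<longrightarrow> d (P m) = 0) \<and> (loewner_le (P N0) (P m) \<longrightarrow> d (P m) = 1)"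
    for m
  proof (cases "m < N0")
    case True
    have "d (P m) \<noteq> 1" using not_less_Least[OF True[unfolded N0_def]] .
    moreover have "loewner_le (P m) (P N0)" using True chain by simp
    then have "loewner_le (P N0) (P m) \<Longrightarrow> P m = P N0" using loewner_antisym by blast
    ultimately show ?thesis using binary[of "P m"] switch_N0 by auto
  next
    case False
    then have "loewner_le (P N0) (P m)" using chain by simp
    then have "\<not> loewner_less (P m) (P N0)"
      unfolding loewner_less_def using loewner_antisym by blast
    moreover have "d (P m) = 1" using upward[OF switch_N0] False by simp
    ultimately show ?thesis by blast
  qed
  then show ?thesis by (intro bexI[of _ "P N0"] ballI) (auto elim!: rangeE)
qed

lemma decision_threshold_or_bounded_orbit:
  assumes Pbar_le: "loewner_le Pbar (fmap A Q Pbar)"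
    and h_incseq: "incseq (\<lambda>n. h ((fmap A Q ^^ n) Pbar))"
    and lam: "0 < lam" and beta: "0 < \<beta>"
  shows "(\<exists>Pth\<in>Sset A Q Pbar. \<forall>P\<in>Sset A Q Pbar.
            (loewner_less P Pth \<longrightarrow> decision A Q Pbar lam E \<beta> h P = 0) \<and>
            (loewner_le Pth P \<longrightarrow> decision A Q Pbar lam E \<beta> h P = 1))
       \<or> ((\<exists>B. \<forall>n. trace ((fmap A Q ^^ n) Pbar) \<le> B) \<and>
          (\<forall>P\<in>Sset A Q Pbar. decision A Q Pbar lam E \<beta> h P = 0))"
proof -
  let ?P = "\<lambda>n. (fmap A Q ^^ n) Pbar"
  let ?d = "decision A Q Pbar lam E \<beta> h"
  define G where "G n = \<beta> * trace (?P (Suc n)) + h (?P (Suc n))" for n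
  define c where "c = \<beta> * trace Pbar + h Pbar"
  have orbit_chain: "m \<le> n \<Longrightarrow> loewner_le (?P m) (?P n)" for m n
    using lyapunov_orbit_loewner_mono[OF Pbar_le] .
  have trace_incseq: "incseq (\<lambda>n. trace (?P n))"
    using lyapunov_orbit_trace_incseq[OF Pbar_le] .
  have "incseq G"
  proof (rule incseq_SucI)
    fix n
    have "trace (?P (Suc n)) \<le> trace (?P (Suc (Suc n)))" "h (?P (Suc n)) \<le> h (?P (Suc (Suc n)))"
      using incseq_SucD[OF trace_incseq, of "Suc n"] incseq_SucD[OF h_incseq, of "Suc n"] by simp_all
    then show "G n \<le> G (Suc n)" unfolding G_def using beta by (intro add_mono mult_left_mono) auto
  qed
  have switch_iff: "?d (?P n) = 1 \<longleftrightarrow> (1 - \<beta>) * E < lam * (G n - c)" for n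
    unfolding decision_eq_1_iff G_def c_def by simp
  have upward: "?d (?P m) = 1 \<Longrightarrow> m \<le> n \<Longrightarrow> ?d (?P n) = 1" for m n
  proof -
    assume "?d (?P m) = 1" "m \<le> n"
    moreover have "lam * (G m - c) \<le> lam * (G n - c)"
      using incseqD[OF \<open>incseq G\<close> \<open>m \<le> n\<close>] lam by (intro mult_left_mono) auto
    ultimately show "?d (?P n) = 1" unfolding switch_iff by linarith
  qed
  have binary: "?d X = 0 \<or> ?d X = 1" for X by (simp add: decision_def)
  show ?thesis
  proof (cases "\<exists>N. ?d (?P N) = 1")
    case True
    then obtain N where switch: "?d (?P N) = 1" by blast
    have "\<exists>Pth\<in>range ?P. \<forall>X\<in>range ?P.
        (loewner_less X Pth \<longrightarrow> ?d X = 0) \<and> (loewner_le Pth X \<longrightarrow> ?d X = 1)"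
      using orbit_chain upward binary switch by (rule threshold_of_monotone_decision)
    then show ?thesis unfolding Sset_def by blast
  next
    case False
    define B where "B = ((1 - \<beta>) * E / lam + \<beta> * trace Pbar) / \<beta>"
    have "\<beta> * trace (?P (Suc n)) \<le> (1 - \<beta>) * E / lam + \<beta> * trace Pbar" for n
    proof -
      have "lam * (G n - c) \<le> (1 - \<beta>) * E" using False switch_iff by (meson not_less)
      then have "G n - c \<le> (1 - \<beta>) * E / lam" using lam by (simp add: field_simps)
      moreover have "h Pbar \<le> h (?P (Suc n))" using incseqD[OF h_incseq, of 0 "Suc n"] by simp
      ultimately show ?thesis unfolding G_def c_def by simp
    qed
    then have "trace (?P (Suc n)) \<le> B" for n
      unfolding B_def using beta by (simp add: le_divide_eq mult.commute)
    then have "trace (?P n) \<le> B" for n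
      using incseq_SucD[OF trace_incseq, of n] order_trans by blast
    moreover have "\<forall>P\<in>Sset A Q Pbar. ?d P = 0"
    proof
      fix X assume "X \<in> Sset A Q Pbar"
      then obtain n where "X = ?P n" unfolding Sset_def by blast
      then show "?d X = 0" using False binary[of X] by auto
    qed
    ultimately show ?thesis by blast
  qed
qed

theorem theorem4:
  fixes A Q Qh Pp Pbar :: "real^'n^'n"
    and C :: "real^'n^'m" and R :: "real^'m^'m"
    and lam E \<beta> :: real
    and K :: nat
    and \<rho> :: real and h :: "real^'n^'n \<Rightarrow> real"
  assumes Q_psd: "psd Q"
    and R_pd: "posdef R"
    and Qh: "psd Qh" "Qh ** Qh = Q"
    and det: "detectable A C"
    and stab: "stabilizable A Qh"
    and Pp_psd: "psd Pp"
    and DARE: "Pp = A ** Pp ** transpose A + Q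
                 - A ** Pp ** transpose C ** matrix_inv (C ** Pp ** transpose C + R)
                     ** C ** Pp ** transpose A"
    and Pbar_def: "Pbar = Pp - Pp ** transpose C ** matrix_inv (C ** Pp ** transpose C + R)
                              ** C ** Pp"
    and lam: "0 < lam" "lam \<le> 1"
    and E: "0 \<le> E"
    and beta: "0 < \<beta>" "\<beta> < 1"
    and K: "1 \<le> K"
    and rvi_h: "\<forall>P\<in>Sset A Q Pbar. (\<lambda>n. rvi A Q Pbar lam E \<beta> n P) \<longlonglongrightarrow> h P"
    and rvi_rho: "(\<lambda>n. bellman A Q Pbar lam E \<beta> (rvi A Q Pbar lam E \<beta> n) Pbar) \<longlonglongrightarrow> \<rho>"
    and bellman_eq: "\<forall>P\<in>Sset A Q Pbar. \<rho> + h P = bellman A Q Pbar lam E \<beta> h P"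
  shows
    "(\<forall>k\<in>{1..K}.
        (\<exists>Pth\<in>Sset A Q Pbar. \<forall>P\<in>Sset A Q Pbar.
            (loewner_less P Pth \<longrightarrow> nu_fin A Q Pbar lam E \<beta> K k P = 0) \<and>
            (loewner_le Pth P \<longrightarrow> nu_fin A Q Pbar lam E \<beta> K k P = 1))
        \<or> (stable A \<and> (\<forall>P\<in>Sset A Q Pbar. nu_fin A Q Pbar lam E \<beta> K k P = 0)))
     \<and>
     ((\<exists>Pth\<in>Sset A Q Pbar. \<forall>P\<in>Sset A Q Pbar.
            (loewner_less P Pth \<longrightarrow> decision A Q Pbar lam E \<beta> h P = 0) \<and>
            (loewner_le Pth P \<longrightarrow> decision A Q Pbar lam E \<beta> h P = 1))
        \<or> (stable A \<and> (\<forall>P\<in>Sset A Q Pbar. decision A Q Pbar lam E \<beta> h P = 0)))"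
proof -
  let ?P = "\<lambda>n. (fmap A Q ^^ n) Pbar"
  have Pbar_le: "loewner_le Pbar (fmap A Q Pbar)"
    using steady_state_riccati[OF R_pd Pp_psd DARE Pbar_def] by simp
  have trace_incseq: "incseq (\<lambda>n. trace (?P n))"
    using lyapunov_orbit_trace_incseq[OF Pbar_le] .
  have stable_if_bounded: "stable A" if "\<forall>n. trace (?P n) \<le> B" for B
  proof (rule stable_if_lyapunov_orbit_bounded[OF Qh stab Pp_psd])
    show "trace ((fmap A Q ^^ n) Pp) \<le> B" for n
      using that steady_state_riccati(1)[OF R_pd Pp_psd DARE Pbar_def, symmetric]
      by (metis funpow_Suc_right o_apply)
  qed
  have h_incseq: "incseq (\<lambda>n. h (?P n))"
  proof (rule rvi_limit_incseq_orbit[OF trace_incseq])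
    show "(\<lambda>m. rvi A Q Pbar lam E \<beta> m (?P n)) \<longlonglongrightarrow> h (?P n)" for n
      using rvi_h unfolding Sset_def by blast
  qed (use lam beta in auto)
  have threshold: "(\<exists>Pth\<in>Sset A Q Pbar. \<forall>P\<in>Sset A Q Pbar.
            (loewner_less P Pth \<longrightarrow> decision A Q Pbar lam E \<beta> g P = 0) \<and>
            (loewner_le Pth P \<longrightarrow> decision A Q Pbar lam E \<beta> g P = 1))
        \<or> (stable A \<and> (\<forall>P\<in>Sset A Q Pbar. decision A Q Pbar lam E \<beta> g P = 0))"
    if "incseq (\<lambda>n. g (?P n))" for g
    using decision_threshold_or_bounded_orbit[OF Pbar_le that lam(1) beta(1)] stable_if_bounded
    by blast
  show ?thesis
    unfolding nu_fin_def Jfin_def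
    by (intro conjI ballI threshold Vrem_incseq_orbit[OF trace_incseq] h_incseq)
      (use lam beta in auto)
qed

end
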